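(* There is an absolute constant $C>0$ such that for infinitely many $n$ the following holds: any distance labeling scheme for the class of undirected unweighted graphs on $n$ vertices with maximum degree $3$ assigns, on some graph of this class, to some vertex a label of at least $\frac{1}{2^{C\sqrt{\log n}}}\textsc{SumIndex}(n)$ bits.
   Context: A distance labeling scheme for a class $\mathcal F$ of graphs consists of a fixed decoding function $f$ and, for each $G\in\mathcal F$, an assignment of binary strings $\mathsf{label}(u)$ to the vertices such that $f(\mathsf{label}(u),\mathsf{label}(v))=\mathrm{dist}_G(u,v)$ for all $u,v\in V(G)$. Sum-Index problem on $\mathbb Z_n$: a string $S\in\{0,1\}^n$ is known to both Alice and Bob; Alice also holds $a\in[0,n-1]$ and Bob holds $b\in[0,n-1]$; each simultaneously sends one message to a referee, who must compute $S_{(a+b)\bmod n}$ from the two messages alone. $\textsc{SumIndex}(n)$ is the communication complexity of this problem: the minimum, over deterministic such protocols, of the maximum message length in bits. *)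

theory Defs
  imports Complex_Main "HOL-Library.Extended_Nat"
begin

definition undirected_graph_on :: "nat \<Rightarrow> (nat \<Rightarrow> nat \<Rightarrow> bool) \<Rightarrow> bool" where
  "undirected_graph_on n E \<longleftrightarrow>
     (\<forall>u v. E u v \<longrightarrow> u < n \<and> v < n) \<and>
     (\<forall>u v. E u v \<longrightarrow> E v u) \<and>
     (\<forall>u. \<not> E u u)"

definition max_degree_3_graphs :: "nat \<Rightarrow> (nat \<Rightarrow> nat \<Rightarrow> bool) set" where
  "max_degree_3_graphs n =
     {E. undirected_graph_on n E \<and> (\<forall>u<n. card {v. E u v} \<le> 3)}"

text \<open>Shortest-path distance (number of edges); infinity if not connected.\<close>

definition graph_dist :: "(nat \<Rightarrow> nat \<Rightarrow> bool) \<Rightarrow> nat \<Rightarrow> nat \<Rightarrow> enat" where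
  "graph_dist E u v = (INF k\<in>{k. (E ^^ k) u v}. enat k)"

definition sum_index_protocol :: "nat \<Rightarrow> nat \<Rightarrow> bool" where
  "sum_index_protocol n k \<longleftrightarrow>
     (\<exists>(A :: bool list \<Rightarrow> nat \<Rightarrow> bool list) (B :: bool list \<Rightarrow> nat \<Rightarrow> bool list)
        (R :: bool list \<Rightarrow> bool list \<Rightarrow> bool).
        \<forall>S a b. length S = n \<and> a < n \<and> b < n \<longrightarrow>
          R (A S a) (B S b) = S ! ((a + b) mod n) \<and>
          length (A S a) \<le> k \<and> length (B S b) \<le> k)"

definition SumIndex :: "nat \<Rightarrow> nat" where
  "SumIndex n = (LEAST k. sum_index_protocol n k)"

definition distance_labeling_scheme ::
  "nat \<Rightarrow> (nat \<Rightarrow> nat \<Rightarrow> bool) set \<Rightarrow> (bool list \<Rightarrow> bool list \<Rightarrow> enat)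
     \<Rightarrow> ((nat \<Rightarrow> nat \<Rightarrow> bool) \<Rightarrow> nat \<Rightarrow> bool list) \<Rightarrow> bool" where
  "distance_labeling_scheme n F f label \<longleftrightarrow>
     (\<forall>G\<in>F. \<forall>u<n. \<forall>v<n. f (label G u) (label G v) = graph_dist G u v)"

end

theory Submission
  imports Defs "HOL-Library.FuncSet" "HOL-Library.Infinite_Set"
begin

text \<open>
  Take \<open>s = 2\<^sup>l\<close> and write \<open>a, b < s\<^sup>l\<close> in base \<open>s\<close>. In a layered graph where layer \<open>i\<close> changes coordinate
  \<open>i\<close> of a vector from \<open>u\<close> to \<open>v\<close> at cost \<open>A + (u - v)\<^sup>2\<close>, getting from \<open>x\<close> to a vector \<open>y\<close> and on to
  \<open>z\<close> through two mirrored halves costs a constant plus \<open>|x - y|\<^sup>2 + |y - z|\<^sup>2\<close>, which by strict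
  convexity is smallest only at the midpoint. For \<open>x = 2a\<close>, \<open>z = 2b\<close> the midpoint is \<open>a + b\<close>, and joining
  the halves at \<open>y\<close> exactly if the bit with index \<open>y\<close> is set makes the distance reveal that bit.
  The graph has \<open>2 ^ O(l)\<close> times \<open>s\<^sup>l\<close> vertices, at most \<open>n = 2 ^ (l + 3)\<^sup>2\<close>, so \<open>2 ^ O(l)\<close> graphs
  suffice for a string of length \<open>n\<close>. The \<open>log n\<close> bits needed for \<open>a\<close> and \<open>b\<close> themselves are absorbed
  because labels within one graph are distinct. All lower bounds on distances come from
  1-Lipschitz functions, so that shortest paths need not be analysed.\<close>

section \<open>Graph distance\<close>

lemma graph_dist_le: "(E ^^ k) u v \<Longrightarrow> graph_dist E u v \<le> enat k"
  unfolding graph_dist_def by (rule INF_lower) simp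

lemma graph_dist_ge: "(\<And>k. (E ^^ k) u v \<Longrightarrow> m \<le> k) \<Longrightarrow> enat m \<le> graph_dist E u v"
  unfolding graph_dist_def by (rule INF_greatest) simp

lemma graph_dist_attained:
  assumes "graph_dist E u v = enat k"
  shows "(E ^^ k) u v"
proof -
  let ?X = "enat ` {k. (E ^^ k) u v}"
  have "?X \<noteq> {}"
    using assms unfolding graph_dist_def by (metis Inf_empty enat.distinct(1) top_enat_def)
  then have "Inf ?X \<in> ?X"
    unfolding Inf_enat_def by (metis (mono_tags, lifting) LeastI all_not_in_conv)
  then show ?thesis
    using assms unfolding graph_dist_def by auto
qed

lemma graph_dist_self [simp]: "graph_dist E u u = 0"
  using graph_dist_le[where E = E and k = 0 and u = u and v = u] by (simp add: zero_enat_def[symmetric])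

lemma graph_dist_eq_0D: "graph_dist E u v = 0 \<Longrightarrow> u = v"
  using graph_dist_attained[of E u v 0] by (simp add: zero_enat_def)

lemma graph_dist_triangle: "graph_dist E u w \<le> graph_dist E u v + graph_dist E v w"
proof (cases "graph_dist E u v")
  case (enat k)
  show ?thesis
  proof (cases "graph_dist E v w")
    case (enat l)
    have "(E ^^ (k + l)) u w"
      using graph_dist_attained[OF \<open>graph_dist E u v = enat k\<close>] graph_dist_attained[OF enat]
      by (auto simp: relpowp_add)
    then show ?thesis
      using graph_dist_le \<open>graph_dist E u v = enat k\<close> enat by fastforce
  qed simp
qed simp

lemma graph_dist_sym:
  assumes "symp E"
  shows "graph_dist E u v = graph_dist E v u"
proof -
  have "(E ^^ k) v u" if "(E ^^ k) u v" for k u v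
    using that
  proof (induction k arbitrary: v)
    case (Suc k)
    then obtain z where "(E ^^ k) u z" "E z v" by auto
    with Suc.IH assms show ?case
      by (metis relpowp_Suc_I2 sympD)
  qed simp
  then have "{k. (E ^^ k) u v} = {k. (E ^^ k) v u}" by blast
  then show ?thesis by (simp add: graph_dist_def)
qed

section \<open>Subdividing a weighted graph\<close>

text \<open>An arc \<open>(a, b, w)\<close> becomes a path of length \<open>w\<close>; its interior points are
  \<open>Inr ((a, b, w), t)\<close> with \<open>0 < t < w\<close>.\<close>

type_synonym 'a arc = "'a \<times> 'a \<times> nat"

fun arc_point :: "'a arc \<Rightarrow> nat \<Rightarrow> 'a + 'a arc \<times> nat" where
  "arc_point (a, b, w) t = (if t = 0 then Inl a else if t = w then Inl b else Inr ((a, b, w), t))"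

definition subdivision :: "'a arc set \<Rightarrow> 'a + 'a arc \<times> nat \<Rightarrow> 'a + 'a arc \<times> nat \<Rightarrow> bool" where
  "subdivision F p q \<longleftrightarrow> (\<exists>e\<in>F. \<exists>t<snd (snd e).
     p = arc_point e t \<and> q = arc_point e (Suc t) \<or> q = arc_point e t \<and> p = arc_point e (Suc t))"

definition incident :: "'a arc set \<Rightarrow> 'a \<Rightarrow> 'a arc set" where
  "incident F a = {e \<in> F. fst e = a \<or> fst (snd e) = a}"

definition lipschitz :: "'a arc set \<Rightarrow> ('a \<Rightarrow> int) \<Rightarrow> bool" where
  "lipschitz F \<phi> \<longleftrightarrow> (\<forall>(a, b, w)\<in>F. \<bar>\<phi> b - \<phi> a\<bar> \<le> int w)"

lemma subdivision_sym: "subdivision F p q \<Longrightarrow> subdivision F q p"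
  unfolding subdivision_def by blast

lemma subdivision_walk:
  assumes "(a, b, w) \<in> F" and "0 < w"
  shows "(subdivision F ^^ w) (Inl a) (Inl b)"
proof -
  have "(subdivision F ^^ t) (arc_point (a, b, w) 0) (arc_point (a, b, w) t)" if "t \<le> w" for t
    using that
  proof (induction t)
    case (Suc t)
    have "subdivision F (arc_point (a, b, w) t) (arc_point (a, b, w) (Suc t))"
      unfolding subdivision_def using assms Suc.prems
      by (intro bexI[of _ "(a, b, w)"] exI[of _ t]) auto
    with Suc show ?case by (meson Suc_leD relpowp_Suc_I)
  qed simp
  from this[of w] assms(2) show ?thesis by simp
qed

text \<open>Inside an arc the function is extended by the smaller of the two bounds coming from the
  ends; it then changes by at most 1 per edge. This is how potentials bound walk lengths from
  below.\<close>

lemma subdivision_potential: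
  assumes "lipschitz F \<phi>" and "(subdivision F ^^ k) (Inl a) (Inl b)"
  shows "\<phi> b - \<phi> a \<le> int k"
proof -
  define \<psi> where "\<psi> p = (case p of Inl a \<Rightarrow> \<phi> a
    | Inr ((a, b, w), t) \<Rightarrow> min (\<phi> a + int t) (\<phi> b + int w - int t))" for p
  \<comment> \<open>The Lipschitz bound makes the interior formula correct at \<open>t = 0\<close>
    and \<open>t = w\<close> as well.\<close>
  have arc: "\<psi> (arc_point (a, b, w) t) = min (\<phi> a + int t) (\<phi> b + int w - int t)"
    if "(a, b, w) \<in> F" for a b w t
  proof -
    have "\<bar>\<phi> b - \<phi> a\<bar> \<le> int w" using assms(1) that by (auto simp: lipschitz_def)
    then show ?thesis by (auto simp: \<psi>_def)
  qed
  have step: "\<psi> q - \<psi> p \<le> 1" if "subdivision F p q" for p q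
  proof -
    from that obtain a b w t where e: "(a, b, w) \<in> F" and
      "p = arc_point (a, b, w) t \<and> q = arc_point (a, b, w) (Suc t) \<or>
       q = arc_point (a, b, w) t \<and> p = arc_point (a, b, w) (Suc t)"
      unfolding subdivision_def by (metis prod_cases3)
    then show ?thesis by (auto simp only: arc[OF e])
  qed
  have "\<psi> q - \<psi> p \<le> int k" if "(subdivision F ^^ k) p q" for p q k
    using that
  proof (induction k arbitrary: q)
    case (Suc k)
    then obtain z where "(subdivision F ^^ k) p z" "subdivision F z q" by auto
    with Suc.IH step[of z q] show ?case by fastforce
  qed simp
  from this[OF assms(2)] show ?thesis by (simp add: \<psi>_def)
qed

lemma subdivision_degree:
  assumes noloop: "\<And>a b w. (a, b, w) \<in> F \<Longrightarrow> a \<noteq> b"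
    and deg: "\<And>a. finite (incident F a) \<and> card (incident F a) \<le> 3"
  shows "finite {q. subdivision F p q} \<and> card {q. subdivision F p q} \<le> 3"
proof (cases p)
  case (Inl a)
  \<comment> \<open>Each incident arc contributes one neighbour, its point next to the end at
    \<open>a\<close>; a loop would contribute two.\<close>
  let ?h = "\<lambda>e. if fst e = a then arc_point e 1 else arc_point e (snd (snd e) - 1)"
  have "{q. subdivision F p q} \<subseteq> ?h ` incident F a"
  proof
    fix q assume "q \<in> {q. subdivision F p q}"
    then obtain b c w t where e: "(b, c, w) \<in> F" "t < w" and
      d: "p = arc_point (b, c, w) t \<and> q = arc_point (b, c, w) (Suc t) \<or>
       q = arc_point (b, c, w) t \<and> p = arc_point (b, c, w) (Suc t)"
      unfolding subdivision_def by auto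
    from d show "q \<in> ?h ` incident F a"
    proof
      assume "p = arc_point (b, c, w) t \<and> q = arc_point (b, c, w) (Suc t)"
      with e Inl have "b = a" "q = ?h (b, c, w)" by (auto split: if_splits)
      with e show ?thesis unfolding incident_def by (intro image_eqI[of _ _ "(b, c, w)"]) auto
    next
      assume "q = arc_point (b, c, w) t \<and> p = arc_point (b, c, w) (Suc t)"
      with e Inl have "c = a" "w = Suc t" "q = arc_point (b, c, w) t" by (auto split: if_splits)
      with e noloop[OF e(1)] show ?thesis
        unfolding incident_def by (intro image_eqI[of _ _ "(b, c, w)"]) auto
    qed
  qed
  with deg show ?thesis
    by (meson card_image_le card_mono finite_imageI finite_subset le_trans)
next
  case (Inr et)
  obtain e t where et: "et = (e, t)" by (cases et)
  have "{q. subdivision F p q} \<subseteq> {arc_point e (t - 1), arc_point e (Suc t)}"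
    using Inr et unfolding subdivision_def by (auto split: if_splits)
  moreover have "card {arc_point e (t - 1), arc_point e (Suc t)} \<le> 3"
    by (simp add: card_insert_if)
  ultimately show ?thesis
    by (meson card_mono finite.emptyI finite.insertI finite_subset le_trans)
qed

lemma subdivision_irrefl:
  assumes "\<And>a b w. (a, b, w) \<in> F \<Longrightarrow> a \<noteq> b"
  shows "\<not> subdivision F p p"
  unfolding subdivision_def using assms by (auto split: if_splits)

section \<open>Realising a graph on the vertices below \<open>n\<close>\<close>

lemma max_degree_3_graph_embedding:
  fixes E :: "'b \<Rightarrow> 'b \<Rightarrow> bool"
  assumes fin: "finite V" and card: "card V \<le> n"
    and E: "\<forall>p q. E p q \<longrightarrow> p \<in> V \<and> q \<in> V" "symp E" "\<And>p. \<not> E p p"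
    and deg: "\<And>p. finite {q. E p q} \<and> card {q. E p q} \<le> 3"
  shows "\<exists>G\<in>max_degree_3_graphs n. \<exists>g. (\<forall>p\<in>V. g p < n) \<and>
    (\<forall>p\<in>V. \<forall>q\<in>V. \<forall>k. (G ^^ k) (g p) (g q) \<longleftrightarrow> (E ^^ k) p q)"
proof -
  obtain g where g: "inj_on g V" "g ` V \<subseteq> {..<n}"
    using inj_on_iff_card_le[OF fin finite_lessThan[of n]] card by auto
  \<comment> \<open>Vertices below \<open>n\<close> outside the image of \<open>V\<close> stay
    isolated.\<close>
  define G where "G u v \<longleftrightarrow> (\<exists>p q. u = g p \<and> v = g q \<and> E p q)" for u v
  have nbr: "{v. G (g p) v} = g ` {q. E p q}" if "p \<in> V" for p
  proof (intro set_eqI iffI)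
    fix v assume "v \<in> {v. G (g p) v}"
    then obtain p' q where "g p = g p'" "v = g q" "E p' q" unfolding G_def by blast
    moreover from this have "p = p'" using inj_onD[OF g(1)] that E(1) by blast
    ultimately show "v \<in> g ` {q. E p q}" by blast
  qed (auto simp: G_def)
  have "card {v. G u v} \<le> 3" for u
  proof (cases "\<exists>v. G u v")
    case True
    then obtain p where "u = g p" "p \<in> V" using E(1) unfolding G_def by blast
    with nbr deg show ?thesis by (metis card_image_le le_trans)
  qed simp
  moreover have "undirected_graph_on n G"
    unfolding undirected_graph_on_def
  proof (intro conjI allI impI)
    show "u < n" "v < n" if "G u v" for u v
      using that E(1) g(2) unfolding G_def by auto
    show "G v u" if "G u v" for u v
      using that E(2) unfolding G_def symp_def by blast
    show "\<not> G u u" for u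
    proof
      assume "G u u"
      then obtain p q where "g p = g q" "E p q" unfolding G_def by metis
      with E(1)[rule_format, of p q] E(3)[of p] inj_onD[OF g(1), of p q] show False by blast
    qed
  qed
  ultimately have "G \<in> max_degree_3_graphs n"
    by (simp add: max_degree_3_graphs_def)
  moreover have "(G ^^ k) (g p) (g q) \<longleftrightarrow> (E ^^ k) p q" if "p \<in> V" "q \<in> V" for p q k
  proof -
    \<comment> \<open>The end point is arbitrary so that the induction also shows that walks never
      leave the image of \<open>V\<close>.\<close>
    have "(G ^^ k) (g p) v \<longleftrightarrow> (\<exists>q\<in>V. v = g q \<and> (E ^^ k) p q)" for k v
    proof (induction k arbitrary: v)
      case 0
      show ?case using that by auto
    next
      case (Suc k)
      have "(G ^^ Suc k) (g p) v \<longleftrightarrow> (\<exists>r\<in>V. (E ^^ k) p r \<and> G (g r) v)"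
        unfolding relpowp.simps relcompp_apply Suc.IH by blast
      also have "\<dots> \<longleftrightarrow> (\<exists>r\<in>V. (E ^^ k) p r \<and> v \<in> g ` {q. E r q})"
        using nbr by blast
      also have "\<dots> \<longleftrightarrow> (\<exists>q\<in>V. v = g q \<and> (E ^^ Suc k) p q)"
        unfolding relpowp.simps relcompp_apply using E(1) by blast
      finally show ?case .
    qed
    then show ?thesis
      using that inj_onD[OF g(1)] by blast
  qed
  ultimately show ?thesis using g(2) by (intro bexI[of _ G] exI[of _ g]) auto
qed

text \<open>Every arc is incident to a vertex, so there are at most \<open>3 * card V\<close> arcs,
  each with fewer than \<open>M\<close> interior points. Later arguments see the graph only through
  arc weights from above and Lipschitz functions from below.\<close>

lemma weighted_graph_embedding:
  fixes F :: "'a arc set"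
  assumes V: "finite V" and F: "\<And>a b w. (a, b, w) \<in> F \<Longrightarrow> a \<in> V \<and> b \<in> V \<and> a \<noteq> b \<and> 0 < w \<and> w \<le> M"
    and deg: "\<And>a. finite (incident F a) \<and> card (incident F a) \<le> 3"
    and n: "card V * (1 + 3 * M) \<le> n"
  obtains G g where "G \<in> max_degree_3_graphs n" "\<And>a. a \<in> V \<Longrightarrow> g a < n"
    "\<And>a b w. (a, b, w) \<in> F \<Longrightarrow> graph_dist G (g a) (g b) \<le> enat w"
    "\<And>\<phi> a b. lipschitz F \<phi> \<Longrightarrow> a \<in> V \<Longrightarrow> b \<in> V \<Longrightarrow>
       enat (nat (\<phi> b - \<phi> a)) \<le> graph_dist G (g a) (g b)"
proof -
  have FV: "F = (\<Union>a\<in>V. incident F a)"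
    using F unfolding incident_def by fastforce
  have finF: "finite F" using FV V deg by (metis finite_UN_I)
  have "card F \<le> (\<Sum>a\<in>V. card (incident F a))" using card_UN_le[OF V] FV by metis
  also have "\<dots> \<le> (\<Sum>a\<in>V. 3)" by (intro sum_mono) (simp add: deg)
  finally have cardF: "card F \<le> 3 * card V" by simp
  let ?V = "Inl ` V \<union> Inr ` (F \<times> {..<M})"
  have "card ?V \<le> card (Inl ` V :: ('a + 'a arc \<times> nat) set) + card (Inr ` (F \<times> {..<M}) :: ('a + 'a arc \<times> nat) set)"
    by (rule card_Un_le)
  also have "\<dots> \<le> card V + card (F \<times> {..<M})"
    using V finF by (intro add_mono card_image_le) auto
  also have "\<dots> \<le> card V + 3 * card V * M"
    using cardF by (simp only: card_cartesian_product card_lessThan add_left_mono mult_le_mono1)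
  also have "\<dots> \<le> n" using n by (simp add: algebra_simps)
  finally have card: "card ?V \<le> n" .
  have pt: "arc_point e t \<in> ?V" if "e \<in> F" "t \<le> snd (snd e)" for e t
    using that F by (cases e) fastforce
  have sub: "\<forall>p q. subdivision F p q \<longrightarrow> p \<in> ?V \<and> q \<in> ?V"
  proof (intro allI impI)
    fix p q assume "subdivision F p q"
    then obtain e t where "e \<in> F" "t < snd (snd e)"
      "p = arc_point e t \<and> q = arc_point e (Suc t) \<or> q = arc_point e t \<and> p = arc_point e (Suc t)"
      unfolding subdivision_def by blast
    with pt[of e t] pt[of e "Suc t"] show "p \<in> ?V \<and> q \<in> ?V" by (metis Suc_leI less_imp_le)
  qed
  have noloop: "\<And>a b w. (a, b, w) \<in> F \<Longrightarrow> a \<noteq> b" using F by blast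
  have finV: "finite ?V" using V finF by simp
  have sym: "symp (subdivision F)" by (simp add: symp_def subdivision_sym)
  have irrefl: "\<not> subdivision F p p" for p using noloop by (rule subdivision_irrefl)
  have degree: "finite {q. subdivision F p q} \<and> card {q. subdivision F p q} \<le> 3" for p
    using noloop deg by (rule subdivision_degree)
  obtain G g where G: "G \<in> max_degree_3_graphs n" "\<forall>p\<in>?V. g p < n"
    "\<forall>p\<in>?V. \<forall>q\<in>?V. \<forall>k. (G ^^ k) (g p) (g q) \<longleftrightarrow> (subdivision F ^^ k) p q"
    using max_degree_3_graph_embedding[OF finV card sub sym irrefl degree] by (elim bexE exE conjE)
  show thesis
  proof (rule that[of G "g \<circ> Inl"])
    show "graph_dist G ((g \<circ> Inl) a) ((g \<circ> Inl) b) \<le> enat w" if "(a, b, w) \<in> F" for a b w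
      using subdivision_walk[OF that] F[OF that] by (intro graph_dist_le) (simp add: G(3))
    show "enat (nat (\<phi> b - \<phi> a)) \<le> graph_dist G ((g \<circ> Inl) a) ((g \<circ> Inl) b)"
      if "lipschitz F \<phi>" "a \<in> V" "b \<in> V" for \<phi> a b
    proof (rule graph_dist_ge)
      fix k assume "(G ^^ k) ((g \<circ> Inl) a) ((g \<circ> Inl) b)"
      then have "(subdivision F ^^ k) (Inl a) (Inl b)" using that by (simp add: G(3))
      with subdivision_potential[OF that(1)] show "nat (\<phi> b - \<phi> a) \<le> k" by fastforce
    qed
  qed (use G(1,2) in auto)
qed

section \<open>The layered graph\<close>

definition sq_diff :: "nat \<Rightarrow> nat \<Rightarrow> nat" where
  "sq_diff u v = nat ((int u - int v)\<^sup>2)"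

lemma int_sq_diff [simp]: "int (sq_diff u v) = (int u - int v)\<^sup>2"
  by (simp add: sq_diff_def)

lemma sq_diff_le:
  assumes "u < D" "v < D"
  shows "sq_diff u v \<le> D\<^sup>2"
proof -
  have "(int u - int v)\<^sup>2 \<le> (int D)\<^sup>2"
    using assms by (subst abs_le_square_iff[symmetric]) auto
  then have "int (sq_diff u v) \<le> int (D\<^sup>2)" by simp
  then show ?thesis by linarith
qed

definition dist2 :: "nat \<Rightarrow> (nat \<Rightarrow> nat) \<Rightarrow> (nat \<Rightarrow> nat) \<Rightarrow> nat" where
  "dist2 i x y = (\<Sum>j<i. sq_diff (x j) (y j))"

lemma dist2_cong: "(\<And>j. j < i \<Longrightarrow> x j = x' j) \<Longrightarrow> (\<And>j. j < i \<Longrightarrow> y j = y' j) \<Longrightarrow> dist2 i x y = dist2 i x' y'"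
  unfolding dist2_def by (intro sum.cong) auto

lemma dist2_Suc: "dist2 (Suc i) x y = dist2 i x y + sq_diff (x i) (y i)"
  by (simp add: dist2_def)

definition vectors :: "nat \<Rightarrow> nat \<Rightarrow> (nat \<Rightarrow> nat) set" where
  "vectors l D = (\<Pi>\<^sub>E i\<in>{..<l}. {..<D})"

lemma vectors_less: "p \<in> vectors l D \<Longrightarrow> i < l \<Longrightarrow> p i < D"
  unfolding vectors_def by auto

lemma vectors_upd: "p \<in> vectors l D \<Longrightarrow> i < l \<Longrightarrow> v < D \<Longrightarrow> p(i := v) \<in> vectors l D"
  unfolding vectors_def by (auto simp: PiE_iff extensional_def)

lemma vectors_eqI: "p \<in> vectors l D \<Longrightarrow> q \<in> vectors l D \<Longrightarrow> (\<And>i. i < l \<Longrightarrow> p i = q i) \<Longrightarrow> p = q"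
  unfolding vectors_def by (rule PiE_ext) auto

lemma vectors_beyond: "p \<in> vectors l D \<Longrightarrow> l \<le> i \<Longrightarrow> p i = undefined"
  unfolding vectors_def by (auto simp: PiE_iff extensional_def)

lemma finite_vectors [simp]: "finite (vectors l D)"
  unfolding vectors_def by (intro finite_PiE) auto

lemma card_vectors: "card (vectors l D) = D ^ l"
  unfolding vectors_def by (simp add: card_PiE)

text \<open>Layer \<open>i\<close> of either half allows coordinate \<open>i\<close> of a vector to be changed from \<open>u\<close> to \<open>v\<close> at
  cost \<open>A + (u - v)\<^sup>2\<close>. To keep the degree at 3, the options are laid out as a crossbar: walk \<open>v\<close> steps
  along the row of the old vector, cross over, then walk \<open>u\<close> steps down the column of the new one;
  the crossing weight makes up for the \<open>u + v\<close> steps.\<close>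

datatype node = Row bool nat "nat \<Rightarrow> nat" nat | Col bool nat "nat \<Rightarrow> nat" nat

fun half :: "node \<Rightarrow> bool" where
  "half (Row s i p v) = s"
| "half (Col s i p v) = s"

locale layered =
  fixes l D :: nat and bit :: "(nat \<Rightarrow> nat) \<Rightarrow> bool"
  assumes l: "0 < l" and D: "4 \<le> D"
begin

text \<open>Large enough to bound \<open>dist2\<close> on vectors, which is what lets
  \<open>excess\<close> be capped at \<open>A\<close>.\<close>

definition A :: nat where "A = l * D\<^sup>2"

definition cross :: "nat \<Rightarrow> nat \<Rightarrow> nat" where
  "cross u v = A + sq_diff u v - u - v"

text \<open>The halves are two copies of one graph, running from layer 0 to the last columns, where
  they are joined; the bits enter only through \<open>link\<close>.\<close>

inductive_set arcs :: "node arc set" where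
  row: "i < l \<Longrightarrow> p \<in> vectors l D \<Longrightarrow> Suc v < D \<Longrightarrow> (Row s i p v, Row s i p (Suc v), 1) \<in> arcs"
| col: "i < l \<Longrightarrow> p \<in> vectors l D \<Longrightarrow> Suc v < D \<Longrightarrow> (Col s i p v, Col s i p (Suc v), 1) \<in> arcs"
| cross: "i < l \<Longrightarrow> p \<in> vectors l D \<Longrightarrow> v < D \<Longrightarrow>
    (Row s i p v, Col s i (p(i := v)) (p i), cross (p i) v) \<in> arcs"
| layer: "Suc i < l \<Longrightarrow> p \<in> vectors l D \<Longrightarrow> (Col s i p 0, Row s (Suc i) p 0, 1) \<in> arcs"
| link: "p \<in> vectors l D \<Longrightarrow> bit p \<Longrightarrow> (Col False (l - 1) p 0, Col True (l - 1) p 0, A) \<in> arcs"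

definition nodes :: "node set" where
  "nodes = (let X = UNIV \<times> {..<l} \<times> vectors l D \<times> {..<D}
     in (\<lambda>(s, i, p, v). Row s i p v) ` X \<union> (\<lambda>(s, i, p, v). Col s i p v) ` X)"

lemma Row_nodes: "Row s i p v \<in> nodes \<longleftrightarrow> i < l \<and> p \<in> vectors l D \<and> v < D"
  unfolding nodes_def Let_def by (auto simp: image_iff)

lemma Col_nodes: "Col s i p v \<in> nodes \<longleftrightarrow> i < l \<and> p \<in> vectors l D \<and> v < D"
  unfolding nodes_def Let_def by (auto simp: image_iff)

lemma finite_nodes: "finite nodes"
  unfolding nodes_def Let_def by simp

lemma card_nodes: "card nodes \<le> 4 * l * D ^ Suc l"
proof -
  let ?X = "(UNIV :: bool set) \<times> {..<l} \<times> vectors l D \<times> {..<D}"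
  have "card nodes \<le> card ((\<lambda>(s, i, p, v). Row s i p v) ` ?X) + card ((\<lambda>(s, i, p, v). Col s i p v) ` ?X)"
    unfolding nodes_def Let_def by (rule card_Un_le)
  also have "\<dots> \<le> card ?X + card ?X"
    by (intro add_mono card_image_le) simp_all
  also have "\<dots> = 4 * l * D ^ Suc l"
    by (simp add: card_cartesian_product card_vectors)
  finally show ?thesis .
qed

lemma D_sq_le_A: "D\<^sup>2 \<le> A"
  using l by (simp add: A_def)

text \<open>The factor 4 serves the reverse direction of a crossing arc in
  \<open>lipschitz_glued\<close>, where \<open>2 * (u + v)\<close> has to stay below
  \<open>A\<close>. It also keeps the subtraction in \<open>cross\<close> from truncating.\<close>

lemma D_le_A: "4 * D \<le> A"
  using mult_le_mono1[OF D, of D] D_sq_le_A unfolding power2_eq_square by (rule order_trans)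

lemma int_cross: "u < D \<Longrightarrow> v < D \<Longrightarrow> int (cross u v) = int A + (int u - int v)\<^sup>2 - int u - int v"
  using D_le_A unfolding cross_def by (simp add: of_nat_diff)

lemma arcs_nodes:
  assumes "(a, b, w) \<in> arcs"
  shows "a \<in> nodes \<and> b \<in> nodes \<and> a \<noteq> b \<and> 0 < w \<and> w \<le> 2 * A"
  using assms
proof (cases rule: arcs.cases)
  case (cross i p v s)
  have "cross (p i) v \<le> 2 * A" "0 < cross (p i) v"
    using sq_diff_le[of "p i" D v] vectors_less cross D_sq_le_A D_le_A
    by (fastforce simp: cross_def)+
  then show ?thesis using cross by (simp add: Row_nodes Col_nodes vectors_upd vectors_less)
qed (use D l D_le_A in \<open>auto simp: Row_nodes Col_nodes\<close>)

text \<open>Entry 0 of a row or column has no predecessor there, which frees a slot for the arc to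
  the adjacent layer or to the other half.\<close>

lemma arcs_degree: "finite (incident arcs a) \<and> card (incident arcs a) \<le> 3"
proof -
  have three: ?thesis if "incident arcs a \<subseteq> {e1, e2, e3}" for e1 e2 e3
  proof -
    have "card {e1, e2, e3} \<le> 3" by (simp add: card_insert_if)
    with that show ?thesis by (meson card_mono finite.emptyI finite.insertI finite_subset le_trans)
  qed
  show ?thesis
  proof (cases a)
    case (Row s i p v)
    show ?thesis
    proof (rule three)
      show "incident arcs a \<subseteq> {(Row s i p v, Row s i p (Suc v), 1),
          (Row s i p v, Col s i (p(i := v)) (p i), cross (p i) v),
          if v = 0 then (Col s (i - 1) p 0, Row s i p 0, 1) else (Row s i p (v - 1), Row s i p v, 1)}"
        (is "_ \<subseteq> ?X")
      proof
        fix e assume "e \<in> incident arcs a"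
        moreover obtain b c w where e: "e = (b, c, w)" by (cases e)
        ultimately have "(b, c, w) \<in> arcs" and inc: "b = a \<or> c = a" by (simp_all add: incident_def)
        from this(1) show "e \<in> ?X"
        proof (cases rule: arcs.cases)
        qed (use inc Row e in auto)
      qed
    qed
  next
    case (Col s i q u)
    show ?thesis
    proof (rule three)
      \<comment> \<open>A crossing arc keeps the old entry as the position and the new one in the
        vector, so its row end can be read off: vector \<open>q(i := u)\<close>, position
        \<open>q i\<close>.\<close>
      show "incident arcs a \<subseteq> {(Col s i q u, Col s i q (Suc u), 1),
          (Row s i (q(i := u)) (q i), Col s i q u, cross u (q i)),
          if 0 < u then (Col s i q (u - 1), Col s i q u, 1)
          else if Suc i < l then (Col s i q 0, Row s (Suc i) q 0, 1)
          else (Col False (l - 1) q 0, Col True (l - 1) q 0, A)}"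
        (is "_ \<subseteq> ?X")
      proof
        fix e assume "e \<in> incident arcs a"
        moreover obtain b c w where e: "e = (b, c, w)" by (cases e)
        ultimately have "(b, c, w) \<in> arcs" and inc: "b = a \<or> c = a" by (simp_all add: incident_def)
        from this(1) show "e \<in> ?X"
        proof (cases rule: arcs.cases)
        qed (use inc Col e l in auto)
      qed
    qed
  qed
qed

section \<open>Potentials and lower bounds\<close>

lemma dist2_le_A:
  assumes "i \<le> l" "x \<in> vectors l D" "y \<in> vectors l D"
  shows "dist2 i x y \<le> A"
proof -
  have "dist2 i x y \<le> (\<Sum>j<i. D\<^sup>2)"
    unfolding dist2_def using assms by (intro sum_mono sq_diff_le) (auto intro: vectors_less)
  also have "\<dots> \<le> A" using assms(1) by (simp add: A_def)
  finally show ?thesis .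
qed

text \<open>A lower bound for the distance to \<open>Row s 0 x 0\<close> within one half, apart from the \<open>A + 1\<close> per layer.
  A vector that disagrees with \<open>x\<close> in a coordinate still to come is only reached by going
  backwards, which costs at least another \<open>A\<close>.\<close>

definition excess :: "(nat \<Rightarrow> nat) \<Rightarrow> nat \<Rightarrow> (nat \<Rightarrow> nat) \<Rightarrow> nat" where
  "excess x i p = (if \<forall>j. i \<le> j \<and> j < l \<longrightarrow> p j = x j then dist2 i x p else A)"

text \<open>On a column the value falls with \<open>u\<close>, because the \<open>u\<close> steps
  down to entry 0 are still ahead.\<close>

fun pot :: "(nat \<Rightarrow> nat) \<Rightarrow> node \<Rightarrow> int" where
  "pot x (Row s i p v) = int i * (int A + 1) + int (excess x i p) + int v"
| "pot x (Col s i p u) = int i * (int A + 1) + int A + int (excess x (Suc i) p) - int u"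

lemma excess_le_A: "i \<le> l \<Longrightarrow> x \<in> vectors l D \<Longrightarrow> p \<in> vectors l D \<Longrightarrow> excess x i p \<le> A"
  by (simp add: excess_def dist2_le_A)

lemma excess_last: "l \<le> i \<Longrightarrow> excess x i p = dist2 i x p"
  by (simp add: excess_def)

text \<open>If \<open>p\<close> agrees with \<open>x\<close> from coordinate \<open>i\<close> on,
  then \<open>p i = x i\<close> and the change adds exactly its square. Otherwise the right side is
  already at least \<open>A\<close>, the cap of \<open>excess\<close>.\<close>

lemma excess_step:
  assumes "i < l" "x \<in> vectors l D" "p \<in> vectors l D" "v < D"
  shows "excess x (Suc i) (p(i := v)) \<le> excess x i p + sq_diff (p i) v"
proof (cases "\<forall>j. i \<le> j \<and> j < l \<longrightarrow> p j = x j")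
  case True
  have "dist2 (Suc i) x (p(i := v)) = dist2 i x p + sq_diff (p i) v"
    using True assms(1) by (simp add: dist2_Suc cong: dist2_cong)
  with True show ?thesis by (simp add: excess_def)
next
  case False
  then have "excess x i p = A" unfolding excess_def by (rule if_not_P)
  with excess_le_A[of "Suc i" x "p(i := v)"] assms show ?thesis
    by (simp add: vectors_upd)
qed

text \<open>Potentials towards \<open>x\<close> in one half and away from \<open>z\<close> in the other, glued along the links.\<close>

lemma lipschitz_glued:
  assumes x: "x \<in> vectors l D" and z: "z \<in> vectors l D"
    and c: "\<And>p. p \<in> vectors l D \<Longrightarrow> bit p \<Longrightarrow> c < dist2 l x p + dist2 l z p"
  shows "lipschitz arcs (\<lambda>a. if half a
    then 2 * (int l * (int A + 1) - 1) + int A + int c + 1 - pot z a else pot x a)"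
proof -
  \<comment> \<open>The condition on the halves excludes exactly the links, which run from half
    \<open>False\<close> to half \<open>True\<close>.\<close>
  have inner: "\<bar>pot x b - pot x a\<bar> \<le> int w \<and> half a = half b"
    if "(a, b, w) \<in> arcs" "half a \<or> \<not> half b" "x \<in> vectors l D" for a b w x
    using that(1)
  proof (cases rule: arcs.cases)
    case (cross i p v s)
    then have "p i < D" using vectors_less by blast
    moreover have "int (excess x (Suc i) (p(i := v))) \<le> int (excess x i p) + (int (p i) - int v)\<^sup>2"
      using excess_step[OF cross(4) that(3) cross(5,6)] by (simp flip: int_sq_diff)
    moreover have "excess x i p \<le> A" using cross that(3) by (intro excess_le_A) auto
    moreover obtain q where "(int (p i) - int v)\<^sup>2 = q" "0 \<le> q" by simp
    ultimately show ?thesis using D_le_A cross by (simp add: int_cross algebra_simps abs_le_iff)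
  qed (use that(2) in \<open>auto simp: algebra_simps\<close>)
  show ?thesis
    unfolding lipschitz_def
  proof safe
    fix a b w assume e: "(a, b, w) \<in> arcs"
    show "\<bar>(if half b then 2 * (int l * (int A + 1) - 1) + int A + int c + 1 - pot z b else pot x b) -
      (if half a then 2 * (int l * (int A + 1) - 1) + int A + int c + 1 - pot z a else pot x a)\<bar> \<le> int w"
    proof (cases "half a \<or> \<not> half b")
      case True
      with inner[OF e True] x z show ?thesis by fastforce
    next
      case False
      with e obtain p where p: "a = Col False (l - 1) p 0" "b = Col True (l - 1) p 0" "w = A"
        "p \<in> vectors l D" "bit p"
        by (cases rule: arcs.cases) auto
      \<comment> \<open>Over a link the potential changes by
        \<open>A + c + 1 - (dist2 l x p + dist2 l z p)\<close>: at most \<open>A\<close> by the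
        hypothesis on \<open>c\<close>, at least \<open>- A\<close> since each distance is at most
        \<open>A\<close>.\<close>
      have "dist2 l x p \<le> A" "dist2 l z p \<le> A" "c < dist2 l x p + dist2 l z p"
        using c x z p dist2_le_A by auto
      moreover have "int (l - 1) * (int A + 1) = int l * (int A + 1) - int A - 1"
        using l by (simp add: of_nat_diff algebra_simps)
      ultimately show ?thesis using l by (simp add: p excess_last)
    qed
  qed
qed

section \<open>Upper bounds from explicit walks\<close>

lemma half_dist_le:
  fixes d :: "node \<Rightarrow> node \<Rightarrow> enat"
  assumes arc: "\<And>a b w. (a, b, w) \<in> arcs \<Longrightarrow> d a b \<le> enat w"
    and self: "\<And>a. d a a = 0" and sym: "\<And>a b. d a b = d b a"
    and tri: "\<And>a b c. d a c \<le> d a b + d b c"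
    and x: "x \<in> vectors l D" and y: "y \<in> vectors l D"
  shows "d (Row s 0 x 0) (Col s (l - 1) y 0) \<le> enat (l * (A + 1) - 1 + dist2 l x y)"
proof -
  have trans: "d a c \<le> enat (k + m)" if "d a b \<le> enat k" "d b c \<le> enat m" for a b c k m
    using tri[of a c b] add_mono[OF that] by simp
  have row: "d (Row s i p 0) (Row s i p v) \<le> enat v" if "i < l" "p \<in> vectors l D" "v < D" for i p v
    using that(3)
  proof (induction v)
    case (Suc v)
    with trans[OF Suc.IH arc[OF arcs.row[OF that(1,2), of v s]]] show ?case by simp
  qed (simp add: self)
  have col: "d (Col s i p v) (Col s i p 0) \<le> enat v" if "i < l" "p \<in> vectors l D" "v < D" for i p v
    using that(3)
  proof (induction v)
    case (Suc v)
    then have "d (Col s i p (Suc v)) (Col s i p v) \<le> enat 1"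
      using arc[OF arcs.col[OF that(1,2), of v s]] sym by metis
    with trans[OF this Suc.IH] Suc.prems show ?case by simp
  qed (simp add: self)
  have layer: "d (Row s i p 0) (Col s i (p(i := v)) 0) \<le> enat (A + sq_diff (p i) v)"
    if "i < l" "p \<in> vectors l D" "v < D" for i p v
  proof -
    have pi: "p i < D" using that vectors_less by blast
    have "d (Row s i p 0) (Col s i (p(i := v)) 0) \<le> enat (v + cross (p i) v + p i)"
      using trans[OF trans[OF row[OF that] arc[OF arcs.cross[OF that]]] col[OF that(1) vectors_upd[OF that(2,1,3)] pi]] .
    also have "v + cross (p i) v + p i = A + sq_diff (p i) v"
      using D_le_A pi that(3) by (simp add: cross_def)
    finally show ?thesis .
  qed
  \<comment> \<open>The walk replaces the coordinates of \<open>x\<close> by those of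
    \<open>y\<close> one at a time; layer \<open>i\<close> turns \<open>mix i\<close> into
    \<open>mix (Suc i)\<close>.\<close>
  define mix where "mix i = (\<lambda>j. if j < i then y j else x j)" for i
  have mix: "mix i \<in> vectors l D" "mix (Suc i) = (mix i)(i := y i)" "mix i i = x i" for i
    using x y unfolding mix_def vectors_def by (auto simp: PiE_iff extensional_def)
  have "d (Row s 0 x 0) (Col s i (mix (Suc i)) 0) \<le> enat (i * (A + 1) + A + dist2 (Suc i) x y)"
    if "i < l" for i
    using that
  proof (induction i)
    case 0
    have "mix 0 = x" by (simp add: mix_def)
    then have "mix (Suc 0) = x(0 := y 0)" using mix(2)[of 0] by (simp only:)
    with layer[OF 0 x vectors_less[OF y 0]] show ?case
      by (simp add: dist2_def del: fun_upd_apply)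
  next
    case (Suc i)
    have "d (Row s 0 x 0) (Col s (Suc i) (mix (Suc (Suc i))) 0) \<le>
        enat (i * (A + 1) + A + dist2 (Suc i) x y + 1 + (A + sq_diff (x (Suc i)) (y (Suc i))))"
      using trans[OF trans[OF Suc.IH arc[OF arcs.layer[OF Suc.prems mix(1)]]]
          layer[OF Suc.prems mix(1) vectors_less[OF y Suc.prems]]] Suc.prems
      unfolding mix(2)[of "Suc i"] mix(3) by (simp del: fun_upd_apply)
    then show ?case by (simp add: dist2_Suc algebra_simps)
  qed
  moreover have "mix l = y"
    using vectors_beyond[OF x] vectors_beyond[OF y] unfolding mix_def by fastforce
  ultimately have "d (Row s 0 x 0) (Col s (l - 1) y 0) \<le> enat ((l - 1) * (A + 1) + A + dist2 l x y)"
    using l by (metis Suc_diff_1 diff_less zero_less_one)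
  \<comment> \<open>All \<open>l\<close> layers cost \<open>A\<close>, but only \<open>l - 1\<close>
    arcs lie between them.\<close>
  also have "(l - 1) * (A + 1) + A = l * (A + 1) - 1"
    using l by (cases l) auto
  finally show ?thesis .
qed

lemma layered_graph:
  assumes n: "4 * l * D ^ Suc l * (1 + 6 * A) \<le> n"
  obtains G g where "G \<in> max_degree_3_graphs n"
    "\<And>s x. x \<in> vectors l D \<Longrightarrow> g (Row s 0 x 0) < n"
    "\<And>x y z. x \<in> vectors l D \<Longrightarrow> y \<in> vectors l D \<Longrightarrow> z \<in> vectors l D \<Longrightarrow> bit y \<Longrightarrow>
       graph_dist G (g (Row False 0 x 0)) (g (Row True 0 z 0))
         \<le> enat (2 * (l * (A + 1) - 1) + A + (dist2 l x y + dist2 l z y))"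
    "\<And>x z c. x \<in> vectors l D \<Longrightarrow> z \<in> vectors l D \<Longrightarrow>
       \<forall>p\<in>vectors l D. bit p \<longrightarrow> c < dist2 l x p + dist2 l z p \<Longrightarrow>
       enat (2 * (l * (A + 1) - 1) + A + c) < graph_dist G (g (Row False 0 x 0)) (g (Row True 0 z 0))"
proof -
  have "card nodes * (1 + 3 * (2 * A)) \<le> n"
    using mult_le_mono1[OF card_nodes, of "1 + 6 * A"] n by simp
  then obtain G g where G: "G \<in> max_degree_3_graphs n" "\<And>a. a \<in> nodes \<Longrightarrow> g a < n"
    and arc: "\<And>a b w. (a, b, w) \<in> arcs \<Longrightarrow> graph_dist G (g a) (g b) \<le> enat w"
    and low: "\<And>\<phi> a b. lipschitz arcs \<phi> \<Longrightarrow> a \<in> nodes \<Longrightarrow> b \<in> nodes \<Longrightarrow>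
       enat (nat (\<phi> b - \<phi> a)) \<le> graph_dist G (g a) (g b)"
    using weighted_graph_embedding[OF finite_nodes arcs_nodes arcs_degree] by metis
  have src: "Row s 0 x 0 \<in> nodes" if "x \<in> vectors l D" for s x
    using that l D by (simp add: Row_nodes)
  have sym: "graph_dist G u v = graph_dist G v u" for u v
    using G(1) by (intro graph_dist_sym) (auto simp: max_degree_3_graphs_def undirected_graph_on_def symp_def)
  note tri = graph_dist_triangle[of G]
  show thesis
  proof (rule that[OF G(1)])
    show "g (Row s 0 x 0) < n" if "x \<in> vectors l D" for s x
      using G(2) src that by blast
  next
    fix x y z assume v: "x \<in> vectors l D" "y \<in> vectors l D" "z \<in> vectors l D" and "bit y"
    define d where "d a b = graph_dist G (g a) (g b)" for a b
    define m where "m = l * (A + 1) - 1"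
    have half: "d (Row s 0 x 0) (Col s (l - 1) y 0) \<le> enat (m + dist2 l x y)"
      if "x \<in> vectors l D" for s x
      unfolding m_def using that v(2)
      by (intro half_dist_le) (auto simp: d_def arc tri intro: sym)
    have "d (Row False 0 x 0) (Row True 0 z 0) \<le>
        d (Row False 0 x 0) (Col False (l - 1) y 0) +
        (d (Col False (l - 1) y 0) (Col True (l - 1) y 0) + d (Col True (l - 1) y 0) (Row True 0 z 0))"
      unfolding d_def by (meson tri add_left_mono order_trans)
    also have "\<dots> \<le> enat (m + dist2 l x y) + (enat A + enat (m + dist2 l z y))"
      using half[OF v(1)] half[OF v(3)] arc[OF arcs.link[OF v(2) \<open>bit y\<close>]] sym
      by (intro add_mono) (simp_all add: d_def)
    also have "\<dots> = enat (2 * m + A + (dist2 l x y + dist2 l z y))" by simp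
    finally show "graph_dist G (g (Row False 0 x 0)) (g (Row True 0 z 0))
         \<le> enat (2 * (l * (A + 1) - 1) + A + (dist2 l x y + dist2 l z y))"
      by (simp add: d_def m_def)
  next
    fix x z c assume v: "x \<in> vectors l D" "z \<in> vectors l D"
      and c: "\<forall>p\<in>vectors l D. bit p \<longrightarrow> c < dist2 l x p + dist2 l z p"
    \<comment> \<open>Hence \<open>pot\<close> vanishes at both sources, and the glued potential
      differs there by its additive constant.\<close>
    have ex: "excess w 0 w = 0" for w by (simp add: excess_def dist2_def)
    have "int (l * (A + 1) - 1) = int l * (int A + 1) - 1"
      using l by (simp add: of_nat_diff algebra_simps)
    then have "2 * (int l * (int A + 1) - 1) + int A + int c + 1 = int (Suc (2 * (l * (A + 1) - 1) + A + c))"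
      by simp
    then have "nat (2 * (int l * (int A + 1) - 1) + int A + int c + 1) = Suc (2 * (l * (A + 1) - 1) + A + c)"
      by (metis nat_int)
    with low[OF lipschitz_glued[OF v c[rule_format]] src[OF v(1), of False] src[OF v(2), of True]]
    have "enat (Suc (2 * (l * (A + 1) - 1) + A + c)) \<le> graph_dist G (g (Row False 0 x 0)) (g (Row True 0 z 0))"
      by (simp add: ex)
    then show "enat (2 * (l * (A + 1) - 1) + A + c) < graph_dist G (g (Row False 0 x 0)) (g (Row True 0 z 0))"
      by (meson Suc_ile_eq)
  qed
qed

end

section \<open>Sum-Index from distances\<close>

lemma digit_sum:
  fixes s :: nat
  shows "a < s ^ l \<Longrightarrow> (\<Sum>j<l. a div s ^ j mod s * s ^ j) = a"
proof (induction l arbitrary: a)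
  case (Suc l)
  then have "0 < s" by (cases s) auto
  \<comment> \<open>Reduction modulo \<open>s ^ l\<close> keeps the lower \<open>l\<close> digits,
    so the induction can peel off the top one.\<close>
  have "(\<Sum>j<l. a div s ^ j mod s * s ^ j) = (\<Sum>j<l. (a mod s ^ l) div s ^ j mod s * s ^ j)"
  proof (intro sum.cong refl)
    fix j assume "j \<in> {..<l}"
    then have "s ^ l = s ^ j * s ^ Suc (l - Suc j)"
      by (metis Suc_diff_Suc add_diff_inverse_nat diff_zero lessThan_iff less_imp_not_less
          minus_nat.diff_0 power_add)
    then have "(a mod s ^ l) div s ^ j mod s = a div s ^ j mod s ^ Suc (l - Suc j) mod s"
      using \<open>0 < s\<close> by (simp add: mod_mult2_eq)
    also have "\<dots> = a div s ^ j mod s"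
      by (simp add: mod_mod_cancel)
    finally show "a div s ^ j mod s * s ^ j = (a mod s ^ l) div s ^ j mod s * s ^ j" by simp
  qed
  also have "\<dots> = a mod s ^ l"
    using Suc.IH \<open>0 < s\<close> by simp
  finally have "(\<Sum>j<Suc l. a div s ^ j mod s * s ^ j) = a mod s ^ l + a div s ^ l mod s * s ^ l"
    by simp
  also have "a div s ^ l mod s = a div s ^ l"
    using Suc.prems by (simp add: less_mult_imp_div_less mult.commute)
  finally show ?case by (simp add: mod_div_mult_eq)
qed simp

definition digits :: "nat \<Rightarrow> nat \<Rightarrow> nat \<Rightarrow> nat \<Rightarrow> nat" where
  "digits l s a j = a div s ^ j mod s"

text \<open>Alice and Bob sit at the vectors \<open>2a\<close> and \<open>2b\<close> of digits, whose midpoint \<open>a + b\<close> has no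
  carries to take care of: its entries are up to \<open>2s - 2\<close> and it still evaluates to the sum in base \<open>s\<close>.\<close>

lemma sum_index_graph:
  assumes "0 < l" "2 \<le> s"
    and n: "4 * l * (2 * s) ^ Suc l * (1 + 6 * (l * (2 * s)\<^sup>2)) \<le> n"
  obtains \<tau> :: "nat \<Rightarrow> nat \<Rightarrow> nat" where
    "\<And>T. \<exists>G\<in>max_degree_3_graphs n. \<exists>\<alpha> \<beta>. \<forall>a<s ^ l. \<forall>b<s ^ l. \<alpha> a < n \<and> \<beta> b < n \<and>
       (graph_dist G (\<alpha> a) (\<beta> b) \<le> enat (\<tau> a b) \<longleftrightarrow> T (a + b))"
proof -
  define D where "D = 2 * s"
  \<comment> \<open>This is the layer cost \<open>A\<close>, named here because the threshold must
    be fixed before \<open>T\<close>.\<close>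
  define w where "w = l * D\<^sup>2"
  define dbl where "dbl a = restrict (\<lambda>j. 2 * digits l s a j) {..<l}" for a
  define mid where "mid a b = restrict (\<lambda>j. digits l s a j + digits l s b j) {..<l}" for a b
  define val where "val p = (\<Sum>j<l. p j * s ^ j)" for p :: "nat \<Rightarrow> nat"
  define c where "c a b = dist2 l (dbl a) (mid a b) + dist2 l (dbl b) (mid a b)" for a b
  have less: "digits l s a j < s" for a j using assms(2) by (simp add: digits_def)
  have dbl: "dbl a \<in> vectors l D" for a
    using less[of a] by (auto simp: dbl_def vectors_def D_def)
  have mid: "mid a b \<in> vectors l D" for a b
    using add_strict_mono[OF less[of a] less[of b]] by (auto simp: mid_def vectors_def D_def mult_2)
  have val_mid: "val (mid a b) = a + b" if "a < s ^ l" "b < s ^ l" for a b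
  proof -
    have "val (mid a b) = (\<Sum>j<l. digits l s a j * s ^ j) + (\<Sum>j<l. digits l s b j * s ^ j)"
      by (simp add: val_def mid_def sum.distrib[symmetric] distrib_right)
    then show ?thesis using digit_sum that by (simp add: digits_def)
  qed
  have gap: "c a b < dist2 l (dbl a) p + dist2 l (dbl b) p" if "p \<in> vectors l D" "p \<noteq> mid a b" for a b p
  proof -
    \<comment> \<open>Parallelogram identity: moving from the midpoint to \<open>p\<close> adds
      twice the squared displacement.\<close>
    have split: "int (sq_diff (dbl a j) (p j) + sq_diff (dbl b j) (p j)) =
        int (sq_diff (dbl a j) (mid a b j) + sq_diff (dbl b j) (mid a b j) + 2 * sq_diff (p j) (mid a b j))"
      if "j < l" for j
      using that by (simp add: dbl_def mid_def power2_eq_square algebra_simps)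
    have "dist2 l (dbl a) p + dist2 l (dbl b) p = c a b + 2 * dist2 l p (mid a b)"
      unfolding c_def dist2_def sum_distrib_left sum.distrib[symmetric]
      using split by (intro sum.cong refl) (simp only: of_nat_eq_iff lessThan_iff)
    moreover have "dist2 l p (mid a b) \<noteq> 0"
    proof
      assume "dist2 l p (mid a b) = 0"
      then have "p j = mid a b j" if "j < l" for j
        using that by (auto simp: dist2_def sq_diff_def)
      with vectors_eqI[OF that(1) mid] that(2) show False by blast
    qed
    ultimately show ?thesis by linarith
  qed
  show thesis
  proof (rule that)
    fix T :: "nat \<Rightarrow> bool"
    interpret layered l D "\<lambda>p. T (val p)"
      using assms(1,2) by unfold_locales (auto simp: D_def)
    have w: "layered.A l D = w" by (simp add: A_def w_def)
    have "4 * l * D ^ Suc l * (1 + 6 * layered.A l D) \<le> n"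
      using n unfolding w w_def unfolding D_def .
    then obtain G g where G: "G \<in> max_degree_3_graphs n"
      and lt: "\<And>s x. x \<in> vectors l D \<Longrightarrow> g (Row s 0 x 0) < n"
      and up: "\<And>x y z. x \<in> vectors l D \<Longrightarrow> y \<in> vectors l D \<Longrightarrow> z \<in> vectors l D \<Longrightarrow> T (val y) \<Longrightarrow>
       graph_dist G (g (Row False 0 x 0)) (g (Row True 0 z 0))
         \<le> enat (2 * (l * (layered.A l D + 1) - 1) + layered.A l D + (dist2 l x y + dist2 l z y))"
      and low: "\<And>x z c. x \<in> vectors l D \<Longrightarrow> z \<in> vectors l D \<Longrightarrow>
       \<forall>p\<in>vectors l D. T (val p) \<longrightarrow> c < dist2 l x p + dist2 l z p \<Longrightarrow>
       enat (2 * (l * (layered.A l D + 1) - 1) + layered.A l D + c)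
         < graph_dist G (g (Row False 0 x 0)) (g (Row True 0 z 0))"
      by (rule layered_graph) iprover
    have "graph_dist G (g (Row False 0 (dbl a) 0)) (g (Row True 0 (dbl b) 0))
        \<le> enat (2 * (l * (w + 1) - 1) + w + c a b) \<longleftrightarrow> T (a + b)" if "a < s ^ l" "b < s ^ l" for a b
    proof (cases "T (a + b)")
      case True
      with up[OF dbl[of a] mid[of a b] dbl[of b]] val_mid[OF that] show ?thesis by (simp add: c_def w)
    next
      case False
      \<comment> \<open>As \<open>T (a + b)\<close> fails, no joined vector has value
        \<open>a + b\<close>, so each of them differs from the midpoint.\<close>
      have "c a b < dist2 l (dbl a) p + dist2 l (dbl b) p" if "p \<in> vectors l D" "T (val p)" for p
        using gap[OF that(1)] False that(2) val_mid[OF \<open>a < s ^ l\<close> \<open>b < s ^ l\<close>] by metis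
      with low[OF dbl[of a] dbl[of b], of "c a b"] False show ?thesis by (simp add: w not_le)
    qed
    then show "\<exists>G\<in>max_degree_3_graphs n. \<exists>\<alpha> \<beta>. \<forall>a<s ^ l. \<forall>b<s ^ l. \<alpha> a < n \<and> \<beta> b < n \<and>
       (graph_dist G (\<alpha> a) (\<beta> b) \<le> enat (2 * (l * (w + 1) - 1) + w + c a b) \<longleftrightarrow> T (a + b))"
      using G lt dbl by (intro bexI[of _ G] exI[of _ "\<lambda>a. g (Row False 0 (dbl a) 0)"]
          exI[of _ "\<lambda>b. g (Row True 0 (dbl b) 0)"]) auto
  qed
qed

section \<open>Protocols built from labels\<close>

lemma sum_index_protocolI:
  fixes A B :: "bool list \<Rightarrow> nat \<Rightarrow> 'm"
  assumes fin: "finite M" "card M \<le> 2 ^ k"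
    and prot: "\<And>S a b. length S = n \<Longrightarrow> a < n \<Longrightarrow> b < n \<Longrightarrow>
      A S a \<in> M \<and> B S b \<in> M \<and> R (A S a) (B S b) = S ! ((a + b) mod n)"
  shows "sum_index_protocol n k"
proof -
  let ?X = "{xs :: bool list. set xs \<subseteq> UNIV \<and> length xs = k}"
  have "card ?X = 2 ^ k" "finite ?X"
    using card_lists_length_eq[of "UNIV :: bool set" k] finite_lists_length_eq[of "UNIV :: bool set" k]
    by simp_all
  \<comment> \<open>Messages from any small enough set are encoded as strings of length
    \<open>k\<close>; the referee applies the inverse of \<open>h\<close>.\<close>
  then obtain h where h: "inj_on h M" "h ` M \<subseteq> ?X"
    using inj_on_iff_card_le[OF fin(1), of ?X] fin(2) by auto
  define g where "g = the_inv_into M h"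
  have g: "g (h m) = m" "length (h m) = k" if "m \<in> M" for m
    using that h by (auto simp: g_def the_inv_into_f_f)
  show ?thesis
    unfolding sum_index_protocol_def
    by (rule exI[of _ "\<lambda>S a. h (A S a)"], rule exI[of _ "\<lambda>S b. h (B S b)"],
        rule exI[of _ "\<lambda>x y. R (g x) (g y)"]) (use prot g in auto)
qed

lemma card_bool_lists_le: "card {xs :: bool list. length xs \<le> L} \<le> 2 ^ Suc L"
  and finite_bool_lists_le: "finite {xs :: bool list. length xs \<le> L}"
proof -
  have "(\<Sum>i\<le>L. (2::nat) ^ i) \<le> 2 ^ Suc L" by (induction L) auto
  then show "card {xs :: bool list. length xs \<le> L} \<le> 2 ^ Suc L"
    using card_lists_length_le[of "UNIV :: bool set" L] by simp
  show "finite {xs :: bool list. length xs \<le> L}"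
    using finite_lists_length_le[of "UNIV :: bool set" L] by simp
qed

text \<open>For equal labels the decoder cannot tell \<open>v\<close> from \<open>u\<close>, so it
  reports distance 0. On the edgeless graph this forces enough label bits to pay for sending
  \<open>a\<close> and \<open>b\<close>.\<close>

lemma labels_inj:
  assumes "distance_labeling_scheme n F f label" "G \<in> F"
  shows "inj_on (label G) {..<n}"
proof (rule inj_onI)
  fix u v assume "u \<in> {..<n}" "v \<in> {..<n}" "label G u = label G v"
  then have "graph_dist G u v = graph_dist G u u"
    using assms unfolding distance_labeling_scheme_def by (metis lessThan_iff)
  then show "u = v" by (simp add: graph_dist_eq_0D)
qed

lemma empty_graph_in_max_degree_3: "(\<lambda>_ _. False) \<in> max_degree_3_graphs n"
  by (simp add: max_degree_3_graphs_def undirected_graph_on_def)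

text \<open>Cutting \<open>S\<close> into \<open>K\<close> overlapping windows of length \<open>2m\<close>: Alice and Bob send their labels in the graphs
  of all windows, since neither knows which one \<open>a + b\<close> falls into.\<close>

lemma sum_index_protocol_of_labels:
  fixes n m K L :: nat
  assumes n: "n = m * K" "n \<le> 2 ^ r" "0 < m"
    and sch: "distance_labeling_scheme n F f label"
    and L: "\<And>G v. G \<in> F \<Longrightarrow> v < n \<Longrightarrow> length (label G v) \<le> L"
    and graph: "\<And>T. \<exists>G\<in>F. \<exists>\<alpha> \<beta>. \<forall>a<m. \<forall>b<m. \<alpha> a < n \<and> \<beta> b < n \<and>
       (graph_dist G (\<alpha> a) (\<beta> b) \<le> enat (\<tau> a b) \<longleftrightarrow> T (a + b))"
  shows "sum_index_protocol n (r + Suc L * K)"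
proof -
  \<comment> \<open>Choice makes the graph a function of \<open>T\<close>; Alice and Bob both know
    \<open>S\<close> and so label the same graph.\<close>
  obtain G \<alpha> \<beta> where G: "\<And>T. G T \<in> F"
    and ab: "\<And>T a b. a < m \<Longrightarrow> b < m \<Longrightarrow> \<alpha> T a < n \<and> \<beta> T b < n \<and>
      (graph_dist (G T) (\<alpha> T a) (\<beta> T b) \<le> enat (\<tau> a b) \<longleftrightarrow> T (a + b))"
    using graph by metis
  define W where "W S c j \<longleftrightarrow> S ! ((c * m + j) mod n)" for S :: "bool list" and c j
  let ?B = "{xs :: bool list. length xs \<le> L}"
  let ?M = "{..<n} \<times> {xs. set xs \<subseteq> ?B \<and> length xs = K}"
  define X where "X S a = (a, map (\<lambda>c. label (G (W S c)) (\<alpha> (W S c) (a mod m))) [0..<K])" for S a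
  define Y where "Y S b = (b, map (\<lambda>c. label (G (W S c)) (\<beta> (W S c) (b mod m))) [0..<K])" for S b
  \<comment> \<open>The block numbers of \<open>a\<close> and \<open>b\<close> select the window and
    the remainders give the offset in it. As \<open>n = m * K\<close>, the sum of the block numbers
    may be reduced modulo \<open>K\<close>.\<close>
  define R where "R = (\<lambda>(a, xs) (b, ys). let c = (a div m + b div m) mod K
    in f (xs ! c) (ys ! c) \<le> enat (\<tau> (a mod m) (b mod m)))"
  show ?thesis
  proof (rule sum_index_protocolI[of ?M _ _ X Y R])
    show "finite ?M" using finite_lists_length_eq[OF finite_bool_lists_le] by simp
    have "card ?M = n * card ?B ^ K"
      by (simp add: card_cartesian_product card_lists_length_eq[OF finite_bool_lists_le])
    also have "\<dots> \<le> 2 ^ r * (2 ^ Suc L) ^ K"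
      by (intro mult_le_mono n power_mono card_bool_lists_le) simp
    also have "\<dots> = 2 ^ (r + Suc L * K)" by (simp only: power_add power_mult)
    finally show "card ?M \<le> 2 ^ (r + Suc L * K)" .
  next
    fix S :: "bool list" and a b assume S: "length S = n" "a < n" "b < n"
    have lt: "\<alpha> T (a mod m) < n" "\<beta> T (b mod m) < n" for T
      using ab[of "a mod m" "b mod m"] n(3) by auto
    define c where "c = (a div m + b div m) mod K"
    have "0 < K" using S n(1) by (cases K) auto
    then have c: "c < K" by (simp add: c_def)
    have "m * c = (m * (a div m + b div m)) mod n"
      unfolding c_def n(1) by (rule mult_mod_right)
    then have "(m * c + (a mod m + b mod m)) mod n
        = (m * (a div m + b div m) + (a mod m + b mod m)) mod n"
      by (simp add: mod_add_left_eq)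
    also have "m * (a div m + b div m) + (a mod m + b mod m) = a + b"
      by (metis (no_types, lifting) ab_semigroup_add_class.add_ac(1) add.left_commute distrib_left mult_div_mod_eq)
    finally have idx: "(c * m + (a mod m + b mod m)) mod n = (a + b) mod n" by (simp add: mult.commute)
    have "f (label (G (W S c)) (\<alpha> (W S c) (a mod m))) (label (G (W S c)) (\<beta> (W S c) (b mod m)))
        = graph_dist (G (W S c)) (\<alpha> (W S c) (a mod m)) (\<beta> (W S c) (b mod m))"
      using sch G lt unfolding distance_labeling_scheme_def by blast
    moreover have "R (X S a) (Y S b) \<longleftrightarrow> f (label (G (W S c)) (\<alpha> (W S c) (a mod m)))
        (label (G (W S c)) (\<beta> (W S c) (b mod m))) \<le> enat (\<tau> (a mod m) (b mod m))"
      using c by (simp add: R_def X_def Y_def Let_def c_def)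
    ultimately have "R (X S a) (Y S b) \<longleftrightarrow> W S c (a mod m + b mod m)"
      using ab[of "a mod m" "b mod m"] n(3) by simp
    then have "R (X S a) (Y S b) = S ! ((a + b) mod n)" by (simp add: W_def idx)
    moreover have "X S a \<in> ?M" "Y S b \<in> ?M"
      using S L[OF G lt(1)] L[OF G lt(2)] by (auto simp: X_def Y_def)
    ultimately show "X S a \<in> ?M \<and> Y S b \<in> ?M \<and> R (X S a) (Y S b) = S ! ((a + b) mod n)" by blast
  qed
qed

section \<open>Choice of parameters\<close>

lemma SumIndex_le_max_label:
  fixes l L :: nat
  assumes l: "0 < l" and n: "n = 2 ^ ((l + 3)\<^sup>2)"
    and sch: "distance_labeling_scheme n (max_degree_3_graphs n) f label"
    and L: "\<And>G v. G \<in> max_degree_3_graphs n \<Longrightarrow> v < n \<Longrightarrow> length (label G v) \<le> L"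
  shows "SumIndex n \<le> L * 2 ^ (6 * (l + 3))"
proof -
  define s where "s = (2::nat) ^ l"
  \<comment> \<open>\<open>(l + 3)^2 = l^2 + (6 * l + 9)\<close> and
    \<open>s ^ l = 2 ^ (l^2)\<close>, so \<open>K\<close> windows cover the string.\<close>
  define K where "K = (2::nat) ^ (6 * l + 9)"
  have s: "2 \<le> s" using l self_le_power[of "2::nat" l] by (simp add: s_def)
  have mK: "n = s ^ l * K"
    unfolding n s_def K_def by (simp add: power_mult[symmetric] power_add[symmetric] power2_eq_square algebra_simps)
  have "l \<le> s" unfolding s_def using less_exp[of l] by simp
  have "4 * l * (2 * s) ^ Suc l * (1 + 6 * (l * (2 * s)\<^sup>2)) \<le> 4 * l * (2 * s) ^ Suc l * (8 * (l * (2 * s)\<^sup>2))"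
    using l s by (intro mult_le_mono2) simp
  also have "\<dots> = 2 ^ 5 * l\<^sup>2 * (2 * s) ^ (l + 3)"
  proof -
    have "(2 * s) ^ (l + 3) = (2 * s) ^ Suc l * (2 * s)\<^sup>2"
      unfolding power_add[symmetric] by (rule arg_cong) simp
    moreover have "4 * l * X * (8 * (l * Y)) = 2 ^ 5 * l\<^sup>2 * (X * Y)" for X Y :: nat
      by (simp add: power2_eq_square)
    ultimately show ?thesis by (simp only:)
  qed
  also have "\<dots> \<le> 2 ^ 5 * s\<^sup>2 * (2 * s) ^ (l + 3)"
    using \<open>l \<le> s\<close> by (intro mult_le_mono power_mono) auto
  also have "\<dots> = 2 ^ (5 + l * 2 + (l + 1) * (l + 3))"
  proof -
    have "2 * s = 2 ^ (l + 1)" by (simp add: s_def)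
    then show ?thesis by (simp only: s_def power_mult power_add)
  qed
  \<comment> \<open>The exponent is \<open>l^2 + 6 * l + 8\<close>, one below
    \<open>(l + 3)^2\<close>; hence the 3.\<close>
  also have "\<dots> \<le> n"
    unfolding n by (intro power_increasing) (simp_all add: power2_eq_square algebra_simps)
  finally obtain \<tau> where \<tau>: "\<And>T. \<exists>G\<in>max_degree_3_graphs n. \<exists>\<alpha> \<beta>. \<forall>a<s ^ l. \<forall>b<s ^ l. \<alpha> a < n \<and> \<beta> b < n \<and>
       (graph_dist G (\<alpha> a) (\<beta> b) \<le> enat (\<tau> a b) \<longleftrightarrow> T (a + b))"
    using sum_index_graph[OF l s] by blast
  have "sum_index_protocol n ((l + 3)\<^sup>2 + Suc L * K)"
    by (rule sum_index_protocol_of_labels[OF mK _ _ sch L \<tau>]) (use s in \<open>auto simp: n\<close>)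
  then have "SumIndex n \<le> (l + 3)\<^sup>2 + Suc L * K"
    unfolding SumIndex_def by (rule Least_le)
  \<comment> \<open>The \<open>n\<close> labels of the edgeless graph are distinct, and at most
    \<open>2 ^ Suc L\<close> strings are available.\<close>
  moreover have rL: "(l + 3)\<^sup>2 \<le> Suc L"
  proof -
    have "card {..<n} \<le> card {xs :: bool list. length xs \<le> L}"
      using L[OF empty_graph_in_max_degree_3]
      by (intro card_inj_on_le[OF labels_inj[OF sch empty_graph_in_max_degree_3]] finite_bool_lists_le) auto
    then have "(2::nat) ^ ((l + 3)\<^sup>2) \<le> 2 ^ Suc L"
      using card_bool_lists_le[of L] by (simp only: n card_lessThan)
    then show ?thesis by (rule power_le_imp_le_exp[rotated]) simp
  qed
  moreover have "1 \<le> L" using rL self_le_power[of "l + 3" 2] by simp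
  ultimately have "SumIndex n \<le> (2 * L) * (2 * K)"
  proof -
    have "(l + 3)\<^sup>2 + Suc L * K \<le> Suc L * 1 + Suc L * K" using rL by simp
    also have "\<dots> \<le> Suc L * K + Suc L * K" unfolding K_def by (intro add_mono mult_le_mono2) simp_all
    also have "\<dots> = Suc L * (2 * K)" by simp
    also have "\<dots> \<le> (2 * L) * (2 * K)" using \<open>1 \<le> L\<close> by (intro mult_le_mono1) simp
    finally show ?thesis by (rule le_trans[OF \<open>SumIndex n \<le> (l + 3)\<^sup>2 + Suc L * K\<close>])
  qed
  also have "\<dots> = L * 2 ^ (6 * l + 11)" by (simp add: K_def power_add)
  also have "\<dots> \<le> L * 2 ^ (6 * (l + 3))" by (intro mult_le_mono2 power_increasing) simp_all
  finally show ?thesis .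
qed

theorem theorem3:
  shows "\<exists>C::real. C > 0 \<and>
    (\<exists>\<^sub>\<infinity>n. \<forall>f label.
       distance_labeling_scheme n (max_degree_3_graphs n) f label \<longrightarrow>
       (\<exists>G\<in>max_degree_3_graphs n. \<exists>v<n.
          real (length (label G v)) \<ge> real (SumIndex n) / 2 powr (C * sqrt (log 2 (real n)))))"
proof (intro exI[of _ 6] conjI)
  show "\<exists>\<^sub>\<infinity>n. \<forall>f label.
       distance_labeling_scheme n (max_degree_3_graphs n) f label \<longrightarrow>
       (\<exists>G\<in>max_degree_3_graphs n. \<exists>v<n.
          real (length (label G v)) \<ge> real (SumIndex n) / 2 powr (6 * sqrt (log 2 (real n))))"
    unfolding INFM_nat
  proof (intro allI)
    fix N :: nat
    define l where "l = Suc N"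
    define n :: nat where "n = 2 ^ ((l + 3)\<^sup>2)"
    have "N < l + 3" by (simp add: l_def)
    also have "\<dots> \<le> (l + 3)\<^sup>2" by (rule self_le_power) simp_all
    also have "\<dots> < n" unfolding n_def by (rule less_exp)
    finally have "N < n" .
    \<comment> \<open>Origin of the constant 6: the square root is \<open>l + 3\<close>, and the
      loss is \<open>2 ^ (6 * (l + 3))\<close>.\<close>
    have "log 2 (real n) = (real (l + 3))\<^sup>2" by (simp add: n_def log_nat_power)
    then have "6 * sqrt (log 2 (real n)) = real (6 * (l + 3))" by simp
    then have rate: "2 powr (6 * sqrt (log 2 (real n))) = 2 ^ (6 * (l + 3))"
      by (metis powr_realpow zero_less_numeral)
    have "\<exists>G\<in>max_degree_3_graphs n. \<exists>v<n.
          real (length (label G v)) \<ge> real (SumIndex n) / 2 powr (6 * sqrt (log 2 (real n)))"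
      if sch: "distance_labeling_scheme n (max_degree_3_graphs n) f label" for f label
    proof (rule ccontr)
      assume no: "\<not> ?thesis"
      define bound where "bound = real (SumIndex n) / 2 ^ (6 * (l + 3))"
      define Q where "Q = {length (label G v) |G v. G \<in> max_degree_3_graphs n \<and> v < n}"
      have small: "real q < bound" if q: "q \<in> Q" for q
      proof -
        obtain G v where "q = length (label G v)" "G \<in> max_degree_3_graphs n" "v < n"
          using q unfolding Q_def by blast
        with no show ?thesis unfolding rate bound_def[symmetric] by (meson not_le)
      qed
      \<comment> \<open>The negated claim itself bounds all label lengths, so the maximum of
        \<open>Q\<close> exists.\<close>
      have "q \<le> nat \<lceil>bound\<rceil>" if "q \<in> Q" for q
        using small[OF that] by linarith
      then have "finite Q" by (meson finite_nat_set_iff_bounded_le)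
      have "Q \<noteq> {}"
        using empty_graph_in_max_degree_3[of n] \<open>N < n\<close> unfolding Q_def by blast
      have "length (label G v) \<le> Max Q" if "G \<in> max_degree_3_graphs n" "v < n" for G v
        using that by (intro Max_ge \<open>finite Q\<close>) (auto simp: Q_def)
      then have "SumIndex n \<le> Max Q * 2 ^ (6 * (l + 3))"
        by (intro SumIndex_le_max_label[OF _ n_def sch]) (simp_all add: l_def)
      then have "real (SumIndex n) \<le> real (Max Q * 2 ^ (6 * (l + 3)))"
        by (simp only: of_nat_le_iff)
      with small[OF Max_in[OF \<open>finite Q\<close> \<open>Q \<noteq> {}\<close>]] show False
        by (simp add: bound_def pos_less_divide_eq)
    qed
    with \<open>N < n\<close> show "\<exists>n>N. \<forall>f label.
       distance_labeling_scheme n (max_degree_3_graphs n) f label \<longrightarrow>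
       (\<exists>G\<in>max_degree_3_graphs n. \<exists>v<n.
          real (length (label G v)) \<ge> real (SumIndex n) / 2 powr (6 * sqrt (log 2 (real n))))"
      by (intro exI[of _ n] conjI allI impI)
  qed
qed simp

end
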